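(* Let $\mathcal P$ be an $N\times N$ matrix with nonnegative elements and let $\mathcal R$ be one of the relations $<,\le,=,\ge,>$. Let $k,s\ge1$ be integers, $\alpha_{[n-\ell]}^{i,j},\beta_{[n-\ell]}^{i,j}\ge0$, and let $\varphi:\mathbb{R}\to\mathbb{R}$ be at least continuously differentiable with $\varphi(h)=h+O(h^2)$ for sufficiently small $h$. Consider the nonstandard multistep multistage method $$y_{[n-1]}^{(1)}=y_{n-1},$$ $$y_{[n-1]}^{(i)}=\sum_{\ell=2}^k\sum_{j=1}^{s}\Big(\alpha_{[n-\ell]}^{i,j}y_{[n-\ell]}^{(j)}+\beta_{[n-\ell]}^{i,j}\varphi(\Delta t)f\big(y_{[n-\ell]}^{(j)}\big)\Big)+\sum_{j=1}^{i-1}\Big(\alpha_{[n-1]}^{i,j}y_{[n-1]}^{(j)}+\beta_{[n-1]}^{i,j}\varphi(\Delta t)f\big(y_{[n-1]}^{(j)}\big)\Big)\quad(i=2,\dots,s+1),$$ $$y_n=y_{[n-1]}^{(s+1)}$$ for the problem $x'(t)=f(x(t))$, $x(t_0)=\tilde x$ on $[t_0,T]$. Assume: (1) There exist a set $\mathcal H\subset\mathbb{R}^N$ and a constant vector $\mu\in\mathbb{R}^N$ such that if $\tilde x\in\mathcal H$, then $\mathcal P x(t)\,\mathcal R\,\mu$ for every $t\in[t_0,T]$. (2) For the starting values of the method, $\mathcal P y_{[n]}^{(i)}\,\mathcal R\,\mu$ holds if $y_{[n]}^{(i)}\in\mathcal H$, for every $n=0,1,\dots,k-1$, $i=1,\dots,s+1$.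 (3) There exists a constant $B_{FE}>0$ such that if $y_n\in\mathcal H$ and $\mathcal P y_n\,\mathcal R\,\mu$, then for every $0\le\Delta t\le B_{FE}$ also $\mathcal P\big(y_n+\Delta t f(y_n)\big)\,\mathcal R\,\mu$. (4) $\varphi(x)\le\mathcal C B_{FE}$ for every $x\ge0$, where $\mathcal C$ is the SSP coefficient of the method, $$\mathcal C=\min\Big\{\alpha_{[n-\ell]}^{i,j}/\beta_{[n-\ell]}^{i,j}:\ \beta_{[n-\ell]}^{i,j}\ne0\Big\},$$ the minimum being taken over all coefficients occurring in the method ($2\le i\le s+1$; $1\le j\le i-1$ for $\ell=1$, and $1\le j\le s$ for $2\le\ell\le k$). Then, for every choice of the stepsize $\Delta t>0$, the method preserves this property of the continuous system: $\mathcal P y_n\,\mathcal R\,\mu$ holds for $n=1,2,\dots,\mathcal N$.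
   Context: Here $x:[t_0,T]\to\mathbb{R}^N$, $f:\mathbb{R}^N\to\mathbb{R}^N$, $\tilde x\in\mathbb{R}^N$, and the problem has a unique solution. Grid: $t_n=t_0+n\Delta t$, $n=0,\dots,\mathcal N$, $t_{\mathcal N}=T$, $\Delta t>0$, $\mathcal N>k$; $y_n\approx x(t_n)$. The coefficients depend on $\ell,i,j$ only (not on $n$). The starting values $y_{[n]}^{(i)}$, $n=0,\dots,k-1$, $i=1,\dots,s+1$, are supplied by a starting procedure. Relations $\mathcal R$ between vectors of $\mathbb{R}^N$ are understood componentwise. In (3), $y_n$ stands for an arbitrary vector with the stated properties. Standing assumptions on the problem: (P1) there is a closed set $S\subset\mathbb{R}^N$ such that $\tilde x\in S$ implies $x(t)\in S$ for all $t\in[t_0,T]$; (P2) there are $M,L>0$ with $\|z\|\le M$ and $\|f(z)\|\le LM$ for all $z\in S$; (P3) $\|f(z_1)-f(z_2)\|\le L\|z_1-z_2\|$ for all $z_1,z_2\in S$. Only covariant methods are considered: replacing $f$ by $f(\cdot-\eta)$ and shifting the starting values by $\eta$ shifts the numerical solution and the internal stages by $\eta$.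
   Formalization: Three conditions are added, without which the claim fails: φ(Δt) ≥ 0 for the stepsize used; all starting values lie in 𝓗; and every computed stage i ≤ s that satisfies 𝒫y 𝓡 μ lies in 𝓗, so that (3) applies to it. *)

theory Defs
  imports "HOL-Analysis.Analysis" "HOL-Library.Landau_Symbols"
begin

definition vec_rel :: "(real \<Rightarrow> real \<Rightarrow> bool) \<Rightarrow> real^'n \<Rightarrow> real^'n \<Rightarrow> bool" where
  "vec_rel R u v \<longleftrightarrow> (\<forall>i. R (u $ i) (v $ i))"

definition ivp_solution ::
  "(real^'n \<Rightarrow> real^'n) \<Rightarrow> real \<Rightarrow> real \<Rightarrow> real^'n \<Rightarrow> (real \<Rightarrow> real^'n) \<Rightarrow> bool" where
  "ivp_solution f t0 T x0 x \<longleftrightarrow>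
     x t0 = x0 \<and>
     (\<forall>t\<in>{t0..T}. (x has_vector_derivative f (x t)) (at t within {t0..T}))"

definition unique_ivp_solution ::
  "(real^'n \<Rightarrow> real^'n) \<Rightarrow> real \<Rightarrow> real \<Rightarrow> real^'n \<Rightarrow> (real \<Rightarrow> real^'n) \<Rightarrow> bool" where
  "unique_ivp_solution f t0 T x0 x \<longleftrightarrow>
     ivp_solution f t0 T x0 x \<and>
     (\<forall>z. ivp_solution f t0 T x0 z \<longrightarrow> (\<forall>t\<in>{t0..T}. z t = x t))"

(* The Euclidean norm is no restriction: S is bounded, and f bounded and Lipschitz on S,
   with respect to one norm iff with respect to every norm, after changing M and L. *)
definition standing_assumptions ::
  "(real^'n \<Rightarrow> real^'n) \<Rightarrow> real \<Rightarrow> real \<Rightarrow> real^'n \<Rightarrow> (real \<Rightarrow> real^'n) \<Rightarrow> bool" where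
  "standing_assumptions f t0 T x0 x \<longleftrightarrow>
     (\<exists>S M L. closed S \<and> (x0 \<in> S \<longrightarrow> (\<forall>t\<in>{t0..T}. x t \<in> S)) \<and>
        M > 0 \<and> L > 0 \<and> (\<forall>z\<in>S. norm z \<le> M \<and> norm (f z) \<le> L * M) \<and>
        L-lipschitz_on S f)"

(* Coefficients: \<alpha> l i j is the coefficient \<alpha>_{[n-l]}^{i,j}, and likewise for \<beta>.
   The triples (l, i, j) below are those that occur in the scheme. *)
definition coeff_indices :: "nat \<Rightarrow> nat \<Rightarrow> (nat \<times> nat \<times> nat) set" where
  "coeff_indices k s =
     {(l, i, j). i \<in> {2..s+1} \<and> (l = 1 \<and> j \<in> {1..i-1} \<or> l \<in> {2..k} \<and> j \<in> {1..s})}"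

definition stage_rhs ::
  "nat \<Rightarrow> nat \<Rightarrow> (nat \<Rightarrow> nat \<Rightarrow> nat \<Rightarrow> real) \<Rightarrow> (nat \<Rightarrow> nat \<Rightarrow> nat \<Rightarrow> real) \<Rightarrow> real \<Rightarrow>
   (real^'n \<Rightarrow> real^'n) \<Rightarrow> (nat \<Rightarrow> nat \<Rightarrow> real^'n) \<Rightarrow> nat \<Rightarrow> nat \<Rightarrow> real^'n" where
  "stage_rhs k s \<alpha> \<beta> h f Y n i =
     (\<Sum>l=2..k. \<Sum>j=1..s. \<alpha> l i j *\<^sub>R Y (n - l) j + (\<beta> l i j * h) *\<^sub>R f (Y (n - l) j)) +
     (\<Sum>j=1..i-1. \<alpha> 1 i j *\<^sub>R Y (n - 1) j + (\<beta> 1 i j * h) *\<^sub>R f (Y (n - 1) j))"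

(* Y m i is the stage y_{[m]}^{(i)} (0 \<le> m < N, 1 \<le> i \<le> s+1), y n the numerical solution at
   the n-th grid point, and h the (nonstandard) step. The stages with m < k are the free
   starting values, so the stage equations start at n - 1 = k; the two equations
   linking y and Y fix the meaning of y_n for every n, the starting phase included. *)
definition method_solution ::
  "nat \<Rightarrow> nat \<Rightarrow> (nat \<Rightarrow> nat \<Rightarrow> nat \<Rightarrow> real) \<Rightarrow> (nat \<Rightarrow> nat \<Rightarrow> nat \<Rightarrow> real) \<Rightarrow> nat \<Rightarrow> real \<Rightarrow>
   (real^'n \<Rightarrow> real^'n) \<Rightarrow> (nat \<Rightarrow> nat \<Rightarrow> real^'n) \<Rightarrow> (nat \<Rightarrow> real^'n) \<Rightarrow> bool" where
  "method_solution k s \<alpha> \<beta> N h f Y y \<longleftrightarrow>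
     (\<forall>n\<in>{1..N}. Y (n - 1) 1 = y (n - 1)) \<and>
     (\<forall>n\<in>{k+1..N}. \<forall>i\<in>{2..s+1}. Y (n - 1) i = stage_rhs k s \<alpha> \<beta> h f Y n i) \<and>
     (\<forall>n\<in>{1..N}. y n = Y (n - 1) (s + 1))"

(* The starting values determine all stages and the numerical solution on the grid. Hence
   "shifted data produce shifted output" says exactly that the shifted sequences solve the scheme
   for the shifted right-hand side. *)
definition covariant_method ::
  "'n::finite itself \<Rightarrow> nat \<Rightarrow> nat \<Rightarrow>
   (nat \<Rightarrow> nat \<Rightarrow> nat \<Rightarrow> real) \<Rightarrow> (nat \<Rightarrow> nat \<Rightarrow> nat \<Rightarrow> real) \<Rightarrow> bool" where
  "covariant_method TYPE('n) k s \<alpha> \<beta> \<longleftrightarrow>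
     (\<forall>N h (f :: real^'n \<Rightarrow> real^'n) Y y \<eta>.
        method_solution k s \<alpha> \<beta> N h f Y y \<longrightarrow>
        method_solution k s \<alpha> \<beta> N h (\<lambda>z. f (z - \<eta>)) (\<lambda>m i. Y m i + \<eta>) (\<lambda>n. y n + \<eta>))"

definition ssp_coefficient ::
  "nat \<Rightarrow> nat \<Rightarrow> (nat \<Rightarrow> nat \<Rightarrow> nat \<Rightarrow> real) \<Rightarrow> (nat \<Rightarrow> nat \<Rightarrow> nat \<Rightarrow> real) \<Rightarrow> real" where
  "ssp_coefficient k s \<alpha> \<beta> =
     Min {\<alpha> l i j / \<beta> l i j | l i j. (l, i, j) \<in> coeff_indices k s \<and> \<beta> l i j \<noteq> 0}"

end

theory Submission
  imports Defs
begin

text \<open>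
  Covariance, tested on the zero solution of the zero right-hand side, forces the coefficients
  \<open>\<alpha>\<close> of every stage to sum to 1. The bound on \<open>\<phi>\<close> turns each
  stage into a convex combination of forward Euler steps of length at most \<open>B\<close>, and the set
  of vectors satisfying the relation is convex, so induction over the stages applies.
\<close>

text \<open>The sum over earlier time levels and the sum over the current one become a single sum
  over a finite set, the form that \<open>convex_sum\<close> expects. The two blocks are disjoint:
  \<open>l\<close> is at least 2 in one and equal to 1 in the other.\<close>

definition stage_indices :: "nat \<Rightarrow> nat \<Rightarrow> nat \<Rightarrow> (nat \<times> nat) set" where
  "stage_indices k s i = {2..k} \<times> {1..s} \<union> {1} \<times> {1..i-1}"

lemma stage_indices_iff:
  assumes "i \<in> {2..s+1}"
  shows "(l, j) \<in> stage_indices k s i \<longleftrightarrow> (l, i, j) \<in> coeff_indices k s"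
  using assms by (auto simp: stage_indices_def coeff_indices_def)

lemma finite_stage_indices [simp]: "finite (stage_indices k s i)"
  by (simp add: stage_indices_def)

lemma finite_coeff_indices: "finite (coeff_indices k s)"
proof (rule finite_subset)
  show "coeff_indices k s \<subseteq> {..k+1} \<times> {..s+1} \<times> {..s+1}"
    by (auto simp: coeff_indices_def)
qed simp

lemma stage_rhs_conv_sum:
  "stage_rhs k s \<alpha> \<beta> h f Y n i =
    (\<Sum>(l, j)\<in>stage_indices k s i. \<alpha> l i j *\<^sub>R Y (n - l) j + (\<beta> l i j * h) *\<^sub>R f (Y (n - l) j))"
proof -
  have "{2..k} \<times> {1..s} \<inter> {1} \<times> {1..i-1} = {}"
    by auto
  then show ?thesis
    unfolding stage_indices_def stage_rhs_def
    by (simp add: sum.union_disjoint sum.cartesian_product [symmetric])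
qed

text \<open>This is the consistency condition of the scheme: with zero right-hand side, a nonzero
  constant sequence satisfies the stage equation only if the weights add up to 1.\<close>

lemma covariant_method_sum_eq_1:
  assumes cov: "covariant_method TYPE('n::finite) k s \<alpha> \<beta>" and i: "i \<in> {2..s+1}"
  shows "(\<Sum>(l, j)\<in>stage_indices k s i. \<alpha> l i j) = 1"
proof -
  \<comment> \<open>The all-ones vector is nonzero in every component, so the scalar factor can be
    read off at the end.\<close>
  define \<eta> :: "real^'n" where "\<eta> = 1"
  \<comment> \<open>\<open>k+1\<close> is the smallest number of steps for which the range
    \<open>{k+1..N}\<close> of the stage equations is nonempty.\<close>
  have "method_solution k s \<alpha> \<beta> (k+1) 0 (\<lambda>z. 0) (\<lambda>m i. 0) (\<lambda>n. 0 :: real^'n)"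
    by (simp add: method_solution_def stage_rhs_def)
  from cov [unfolded covariant_method_def, rule_format, OF this, of \<eta>]
  have "\<eta> = stage_rhs k s \<alpha> \<beta> 0 (\<lambda>z. 0) (\<lambda>m i. \<eta>) (k+1) i"
    using i by (simp add: method_solution_def)
  also have "\<dots> = (\<Sum>(l, j)\<in>stage_indices k s i. \<alpha> l i j) *\<^sub>R \<eta>"
    by (simp add: stage_rhs_conv_sum scaleR_sum_left case_prod_unfold)
  finally show ?thesis
    by (simp add: \<eta>_def vec_eq_iff)
qed

lemma ssp_coefficient_le:
  assumes "(l, i, j) \<in> coeff_indices k s" "\<beta> l i j \<noteq> 0"
  shows "ssp_coefficient k s \<alpha> \<beta> \<le> \<alpha> l i j / \<beta> l i j"
  unfolding ssp_coefficient_def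
proof (rule Min_le)
  \<comment> \<open>\<open>Min_le\<close> asks for finiteness, which the quotients inherit from the
    finite index set.\<close>
  have "{\<alpha> l i j / \<beta> l i j |l i j. (l, i, j) \<in> coeff_indices k s \<and> \<beta> l i j \<noteq> 0}
      \<subseteq> (\<lambda>(l, i, j). \<alpha> l i j / \<beta> l i j) ` coeff_indices k s"
    by force
  then show "finite {\<alpha> l i j / \<beta> l i j |l i j. (l, i, j) \<in> coeff_indices k s \<and> \<beta> l i j \<noteq> 0}"
    using finite_coeff_indices finite_surj by blast
qed (use assms in blast)

text \<open>Comparing a real number with a constant cuts out a ray or a single point, which is
  convex. Each component of \<open>P *v z\<close> is linear in \<open>z\<close>, so the set is an
  intersection of convex preimages.\<close>

lemma convex_vec_rel:
  fixes P :: "real^'n^'m"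
  assumes "R \<in> {(<), (\<le>), (=), (\<ge>), (>)}"
  shows "convex {z. vec_rel R (P *v z) \<mu>}"
proof -
  have half: "convex {a. R a c}" for c :: real
  proof -
    have "{a. R a c} \<in> {{..<c}, {..c}, {c}, {c..}, {c<..}}"
      using assms by auto
    moreover have "convex S" if "S \<in> {{..<c}, {..c}, {c}, {c..}, {c<..}}" for S
      using that by auto
    ultimately show ?thesis
      by blast
  qed
  have "linear (\<lambda>z. (P *v z) $ i)" for i
    using bounded_linear_compose [OF bounded_linear_vec_nth matrix_vector_mul_bounded_linear]
    by (rule bounded_linear.linear)
  then have "convex ((\<lambda>z. (P *v z) $ i) -` {a. R a (\<mu> $ i)})" for i
    using convex_linear_vimage half by blast
  then have "convex (\<Inter>i. (\<lambda>z. (P *v z) $ i) -` {a. R a (\<mu> $ i)})"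
    by (intro convex_INT)
  also have "(\<Inter>i. (\<lambda>z. (P *v z) $ i) -` {a. R a (\<mu> $ i)}) = {z. vec_rel R (P *v z) \<mu>}"
    by (auto simp: vec_rel_def)
  finally show ?thesis .
qed

text \<open>For nonzero \<alpha>, each summand is \<alpha> times an Euler step of length
  \<open>\<beta> l i j * h / \<alpha> l i j\<close>, and the SSP coefficient is the factor that
  keeps this length at most \<open>B\<close>.\<close>

lemma stage_rhs_in_convex:
  fixes f :: "real^'n \<Rightarrow> real^'n"
  assumes C: "convex C" and i: "i \<in> {2..s+1}"
    and nonneg: "\<And>l j. (l, i, j) \<in> coeff_indices k s \<Longrightarrow> \<alpha> l i j \<ge> 0 \<and> \<beta> l i j \<ge> 0"
    and sum1: "(\<Sum>(l, j)\<in>stage_indices k s i. \<alpha> l i j) = 1"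
    and h: "0 \<le> h" "h \<le> ssp_coefficient k s \<alpha> \<beta> * B" and B: "B \<ge> 0"
    and euler: "\<And>l j \<tau>. (l, i, j) \<in> coeff_indices k s \<Longrightarrow> 0 \<le> \<tau> \<Longrightarrow> \<tau> \<le> B \<Longrightarrow>
      Y (n - l) j + \<tau> *\<^sub>R f (Y (n - l) j) \<in> C"
  shows "stage_rhs k s \<alpha> \<beta> h f Y n i \<in> C"
proof -
  (* If a coefficient \<alpha> vanishes, division by zero makes \<tau> zero. *)
  define \<tau> where "\<tau> l j = \<beta> l i j * h / \<alpha> l i j" for l j
  define Z where "Z l j = Y (n - l) j + \<tau> l j *\<^sub>R f (Y (n - l) j)" for l j
  \<comment> \<open>The estimate avoids division by \<alpha>, so it also covers a vanishing
    \<alpha>.\<close>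
  have bound: "\<beta> l i j * h \<le> \<alpha> l i j * B" if "(l, i, j) \<in> coeff_indices k s" for l j
  proof (cases "\<beta> l i j = 0")
    case True
    then show ?thesis
      using nonneg [OF that] B by simp
  next
    case False
    then have "\<beta> l i j > 0"
      using nonneg [OF that] by simp
    have "h \<le> \<alpha> l i j / \<beta> l i j * B"
      using h(2) mult_right_mono [OF ssp_coefficient_le B, of l i j k s \<beta> \<alpha>] that False by linarith
    then show ?thesis
      using \<open>\<beta> l i j > 0\<close> by (simp add: field_simps)
  qed
  have \<tau>: "0 \<le> \<tau> l j \<and> \<tau> l j \<le> B \<and> \<alpha> l i j * \<tau> l j = \<beta> l i j * h"
    if "(l, i, j) \<in> coeff_indices k s" for l j
  proof (cases "\<alpha> l i j = 0")
    case True
    \<comment> \<open>Since \<open>bound\<close> gives the opposite inequality when \<alpha> is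
      zero, the product vanishes: such a summand has no \<open>f\<close> term left over.\<close>
    have "\<beta> l i j * h \<ge> 0"
      using nonneg [OF that] h(1) by simp
    then show ?thesis
      using True bound [OF that] B by (simp add: \<tau>_def)
  next
    case False
    then have "\<alpha> l i j > 0"
      using nonneg [OF that] by simp
    then show ?thesis
      using nonneg [OF that] h(1) bound [OF that] by (simp add: \<tau>_def field_simps)
  qed
  have "stage_rhs k s \<alpha> \<beta> h f Y n i = (\<Sum>(l, j)\<in>stage_indices k s i. \<alpha> l i j *\<^sub>R Z l j)"
    unfolding stage_rhs_conv_sum
  proof (rule sum.cong [OF refl], clarify)
    fix l j
    assume "(l, j) \<in> stage_indices k s i"
    then have "\<alpha> l i j * \<tau> l j = \<beta> l i j * h"
      using \<tau> i by (simp add: stage_indices_iff)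
    then show "\<alpha> l i j *\<^sub>R Y (n - l) j + (\<beta> l i j * h) *\<^sub>R f (Y (n - l) j) = \<alpha> l i j *\<^sub>R Z l j"
      by (simp add: Z_def scaleR_right_distrib)
  qed
  also have "\<dots> = (\<Sum>p\<in>stage_indices k s i. \<alpha> (fst p) i (snd p) *\<^sub>R Z (fst p) (snd p))"
    by (simp add: case_prod_unfold)
  also have "\<dots> \<in> C"
  proof (rule convex_sum [OF _ C])
    show "(\<Sum>p\<in>stage_indices k s i. \<alpha> (fst p) i (snd p)) = 1"
      using sum1 by (simp add: case_prod_unfold)
  next
    fix p
    assume "p \<in> stage_indices k s i"
    then have p: "(fst p, i, snd p) \<in> coeff_indices k s"
      using stage_indices_iff [OF i, of "fst p" "snd p"] by simp
    show "0 \<le> \<alpha> (fst p) i (snd p)"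
      using nonneg [OF p] by simp
    show "Z (fst p) (snd p) \<in> C"
      unfolding Z_def using euler [OF p] \<tau> [OF p] by simp
  qed simp
  finally show ?thesis .
qed

theorem theorem6:
  fixes P :: "real^'n^'n"
    and R :: "real \<Rightarrow> real \<Rightarrow> bool"
    and k s N :: nat
    and \<alpha> \<beta> :: "nat \<Rightarrow> nat \<Rightarrow> nat \<Rightarrow> real"
    and \<phi> :: "real \<Rightarrow> real"
    and f :: "real^'n \<Rightarrow> real^'n"
    and x :: "real \<Rightarrow> real^'n" and x0 :: "real^'n"
    and t0 T \<Delta>t B :: real
    and H :: "(real^'n) set" and \<mu> :: "real^'n"
    and Y :: "nat \<Rightarrow> nat \<Rightarrow> real^'n" and y :: "nat \<Rightarrow> real^'n"
  assumes P_nonneg: "\<And>i j. P $ i $ j \<ge> 0"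
    and R: "R \<in> {(<), (\<le>), (=), (\<ge>), (>)}"
    and ks: "k \<ge> 1" "s \<ge> 1"
    and coeff_nonneg: "\<And>l i j. (l, i, j) \<in> coeff_indices k s \<Longrightarrow> \<alpha> l i j \<ge> 0 \<and> \<beta> l i j \<ge> 0"
    and covariant: "covariant_method TYPE('n) k s \<alpha> \<beta>"
    and \<phi>_C1: "\<phi> C1_differentiable_on UNIV"
    and \<phi>_asymp: "(\<lambda>h. \<phi> h - h) \<in> O[at 0](\<lambda>h. h\<^sup>2)"
    and problem: "unique_ivp_solution f t0 T x0 x" "standing_assumptions f t0 T x0 x"
    and grid: "\<Delta>t > 0" "N > k" "T = t0 + real N * \<Delta>t"
    and step_nonneg: "\<phi> \<Delta>t \<ge> 0"
    and scheme: "method_solution k s \<alpha> \<beta> N (\<phi> \<Delta>t) f Y y"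
    and continuous_property: "x0 \<in> H \<Longrightarrow> \<forall>t\<in>{t0..T}. vec_rel R (P *v x t) \<mu>"
    and starting_property:
      "\<And>n i. n \<le> k - 1 \<Longrightarrow> i \<in> {1..s+1} \<Longrightarrow> Y n i \<in> H \<Longrightarrow> vec_rel R (P *v Y n i) \<mu>"
    and starting_in_H: "\<And>n i. n \<le> k - 1 \<Longrightarrow> i \<in> {1..s+1} \<Longrightarrow> Y n i \<in> H"
    and stages_in_H:
      "\<And>n i. n \<in> {k..N-1} \<Longrightarrow> i \<in> {1..s} \<Longrightarrow> vec_rel R (P *v Y n i) \<mu> \<Longrightarrow> Y n i \<in> H"
    and B_pos: "B > 0"
    and euler_property:
      "\<And>z h. z \<in> H \<Longrightarrow> vec_rel R (P *v z) \<mu> \<Longrightarrow> 0 \<le> h \<Longrightarrow> h \<le> B \<Longrightarrow>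
         vec_rel R (P *v (z + h *\<^sub>R f z)) \<mu>"
    and \<phi>_bound: "\<And>h. h \<ge> 0 \<Longrightarrow> \<phi> h \<le> ssp_coefficient k s \<alpha> \<beta> * B"
  shows "\<forall>n\<in>{1..N}. vec_rel R (P *v y n) \<mu>"
proof -
  define C where "C = {z. vec_rel R (P *v z) \<mu>}"
  have convex: "convex C"
    unfolding C_def using R by (rule convex_vec_rel)
  have first_stage: "Y (n - 1) 1 = y (n - 1)"
    and last_stage: "y n = Y (n - 1) (s + 1)" if "n \<in> {1..N}" for n
    using scheme that unfolding method_solution_def by blast+
  have inner_stage: "Y (n - 1) i = stage_rhs k s \<alpha> \<beta> (\<phi> \<Delta>t) f Y n i"
    if "n \<in> {k+1..N}" "i \<in> {2..s+1}" for n i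
    using scheme that unfolding method_solution_def by blast
  \<comment> \<open>The claim is strengthened from \<open>y\<close> to all stages, since the scheme
    refers back to the inner stages of earlier levels. It reaches back up to \<open>k\<close>
    levels, hence the strong induction.\<close>
  have stages: "\<forall>i\<in>{1..s+1}. Y m i \<in> C" if "m < N" for m
    using that
  proof (induction m rule: less_induct)
    case (less m)
    show ?case
    proof (cases "m < k")
      case True
      then show ?thesis
        using starting_property starting_in_H by (auto simp: C_def)
    next
      case False
      then have m: "k \<le> m" "1 \<le> m"
        using ks by auto
      \<comment> \<open>The method is explicit: within one level a stage uses only stages of smaller
        index, which allows an inner induction on \<open>i\<close>.\<close>
      have "Y m i \<in> C" if "1 \<le> i" "i \<le> s + 1" for i
        using that
      proof (induction i rule: less_induct)
        case (less i)
        show ?case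
        proof (cases "i = 1")
          case True
          \<comment> \<open>The first stage has no formula of its own; it copies the last stage of
            level \<open>m - 1\<close>, which exists because \<open>m\<close> is at least 1.\<close>
          have "Y m 1 = y m"
            using first_stage [of "m + 1"] \<open>m < N\<close> by simp
          also have "\<dots> = Y (m - 1) (s + 1)"
            using last_stage \<open>m < N\<close> m by simp
          finally show ?thesis
            using \<open>i = 1\<close> m \<open>m < N\<close> less.prems
              \<open>\<And>m'. m' < m \<Longrightarrow> m' < N \<Longrightarrow> \<forall>i\<in>{1..s+1}. Y m' i \<in> C\<close> by simp
        next
          case False
          then have i: "i \<in> {2..s+1}"
            using less.prems by auto
          \<comment> \<open>Level \<open>m\<close> is computed by the equations with
            \<open>n = m + 1\<close>, so their range from \<open>k + 1\<close> on matches
            \<open>m\<close> being at least \<open>k\<close>.\<close>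
          have "Y m i = stage_rhs k s \<alpha> \<beta> (\<phi> \<Delta>t) f Y (m + 1) i"
            using inner_stage [of "m + 1" i] \<open>m < N\<close> m i by simp
          also have "\<dots> \<in> C"
          proof (rule stage_rhs_in_convex [OF convex i coeff_nonneg
                covariant_method_sum_eq_1 [OF covariant i] step_nonneg \<phi>_bound])
            fix l j \<tau>
            assume lj: "(l, i, j) \<in> coeff_indices k s" and \<tau>: "0 \<le> \<tau>" "\<tau> \<le> B"
            have j: "1 \<le> j" "j \<le> s" and "m + 1 - l < N" and "m + 1 - l \<le> m"
              using lj \<open>m < N\<close> by (auto simp: coeff_indices_def)
            have in_C: "Y (m + 1 - l) j \<in> C"
            \<comment> \<open>For \<open>l = 1\<close> the stage lies on the same level with
              \<open>j < i\<close>, so the inner induction hypothesis applies; for larger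
              \<open>l\<close> it lies on an earlier level, which the outer one covers.\<close>
            proof (cases "l = 1")
              case True
              then show ?thesis
                using lj less.IH [of j] j by (auto simp: coeff_indices_def)
            next
              case False
              then have "m + 1 - l < m"
                using lj m by (auto simp: coeff_indices_def)
              then show ?thesis
                using \<open>\<And>m'. m' < m \<Longrightarrow> m' < N \<Longrightarrow> \<forall>i\<in>{1..s+1}. Y m' i \<in> C\<close>
                  \<open>m + 1 - l < N\<close> j by simp
            qed
            \<comment> \<open>The Euler condition also asks for membership in \<open>H\<close>.
              Starting levels have it by assumption; on later levels it follows from the relation
              just shown, for the stages \<open>j\<close> up to \<open>s\<close> at which
              \<open>f\<close> is evaluated.\<close>
            have "Y (m + 1 - l) j \<in> H"
            proof (cases "m + 1 - l < k")
              case True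
              then show ?thesis
                using starting_in_H j by simp
            next
              case False
              then show ?thesis
                using stages_in_H in_C \<open>m + 1 - l < N\<close> j by (simp add: C_def)
            qed
            then show "Y (m + 1 - l) j + \<tau> *\<^sub>R f (Y (m + 1 - l) j) \<in> C"
              using euler_property in_C \<tau> by (simp add: C_def)
          qed (use grid B_pos in auto)
          finally show ?thesis .
        qed
      qed
      then show ?thesis
        by simp
    qed
  qed
  show ?thesis
  proof
    fix n
    assume n: "n \<in> {1..N}"
    then have "y n = Y (n - 1) (s + 1)"
      by (rule last_stage)
    then show "vec_rel R (P *v y n) \<mu>"
      using stages [of "n - 1"] n by (auto simp: C_def)
  qed
qed

end
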